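(* Let $1\le d\le n-1$, and let $\mu:\binom{[n]}{d}\to\mathbb{R}$ and $\nu:\binom{[n]}{d+1}\to\mathbb{R}$ be any two functions satisfying the 3-term tropical incidence relations: for all $S\in\binom{[n]}{d-1}$ and all distinct $i,j,k\in[n]\setminus S$, the minimum $$\min\bigl(\mu(Si)+\nu(Sjk),\ \mu(Sj)+\nu(Sik),\ \mu(Sk)+\nu(Sij)\bigr)$$ is attained at least twice. Then $\mu$ and $\nu$ are valuated matroids.
   Context: Notation: $Si=S\cup\{i\}$, $Sij=S\cup\{i,j\}$, etc. A function $\mu:\binom{[n]}{d}\to\mathbb{R}$ is a valuated matroid (on the uniform matroid of rank $d$ on $[n]$) if it satisfies the 3-term Plücker relations: for each $S\in\binom{[n]}{d-2}$ and distinct $i,j,k,l\in[n]\setminus S$, the minimum in $\min\bigl(\mu(Sij)+\mu(Skl),\ \mu(Sik)+\mu(Sjl),\ \mu(Sil)+\mu(Sjk)\bigr)$ is attained at least twice (the condition is vacuous if no such $S,i,j,k,l$ exist). *)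

theory Defs
  imports Complex_Main
begin

definition min_attained_twice :: "real list \<Rightarrow> bool" where
  "min_attained_twice xs \<longleftrightarrow> card {i. i < length xs \<and> xs ! i = Min (set xs)} \<ge> 2"

text \<open>
  A function on the \<open>k\<close>-subsets of \<open>{1..n}\<close> is represented by a total function on
  \<^typ>\<open>nat set\<close>; only its values on the \<open>k\<close>-subsets of \<open>{1..n}\<close> are used below.
  The sizes \<open>d - 2\<close> and \<open>d - 1\<close> are written as \<open>card S + 2 = d\<close> and \<open>card S + 1 = d\<close>, so
  that there is no such \<open>S\<close> when the size would be negative.
\<close>

definition valuated_matroid :: "nat \<Rightarrow> nat \<Rightarrow> (nat set \<Rightarrow> real) \<Rightarrow> bool" where
  "valuated_matroid n d \<mu> \<longleftrightarrow>
     (\<forall>S i j k l. S \<subseteq> {1..n} \<and> card S + 2 = d \<and> {i, j, k, l} \<subseteq> {1..n} - S \<and> distinct [i, j, k, l] \<longrightarrow>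
        min_attained_twice
          [\<mu> (S \<union> {i, j}) + \<mu> (S \<union> {k, l}),
           \<mu> (S \<union> {i, k}) + \<mu> (S \<union> {j, l}),
           \<mu> (S \<union> {i, l}) + \<mu> (S \<union> {j, k})])"

definition tropical_incidence_relations ::
    "nat \<Rightarrow> nat \<Rightarrow> (nat set \<Rightarrow> real) \<Rightarrow> (nat set \<Rightarrow> real) \<Rightarrow> bool" where
  "tropical_incidence_relations n d \<mu> \<nu> \<longleftrightarrow>
     (\<forall>S i j k. S \<subseteq> {1..n} \<and> card S + 1 = d \<and> {i, j, k} \<subseteq> {1..n} - S \<and> distinct [i, j, k] \<longrightarrow>
        min_attained_twice
          [\<mu> (S \<union> {i}) + \<nu> (S \<union> {j, k}),
           \<mu> (S \<union> {j}) + \<nu> (S \<union> {i, k}),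
           \<mu> (S \<union> {k}) + \<nu> (S \<union> {i, j})])"

end

theory Submission
  imports Defs
begin

text \<open>
  Each Pluecker relation only involves four elements \<open>i, j, k, l\<close>. After a rescaling of the six
  values of \<open>\<mu>\<close> (resp. \<open>\<nu>\<close>) by the four relevant values of \<open>\<nu>\<close> (resp. \<open>\<mu>\<close>), the incidence
  relations say that in the complete graph \<open>K\<^sub>4\<close> with weighted edges the minimum on the star of
  every vertex (resp. on every triangle) is attained twice, and the Pluecker relation says
  that the minimum over the three perfect matchings is attained twice. Replacing every edge by its
  opposite edge exchanges stars and triangles and fixes the matchings, so stars suffice.
  Starting from an edge of minimal weight \<open>m\<close>, the star conditions produce either two perfect
  matchings of weight \<open>2 m\<close>, or a triangle of weight-\<open>m\<close> edges; in the latter case the weights of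
  the matchings are \<open>m\<close> plus the weights in the star of the fourth vertex.
\<close>

lemma min_attained_twice_3_iff:
  "min_attained_twice [a, b, c] \<longleftrightarrow>
     (a = b \<and> a \<le> c) \<or> (a = c \<and> a \<le> b) \<or> (b = c \<and> b \<le> a)"
proof -
  define m where "m = Min (set [a, b, c])"
  have m: "m \<le> a" "m \<le> b" "m \<le> c" "m = a \<or> m = b \<or> m = c"
    unfolding m_def by (auto simp: min_def)
  have "{t. t < length [a, b, c] \<and> [a, b, c] ! t = m} =
      (if a = m then {0} else {}) \<union> (if b = m then {1} else {}) \<union> (if c = m then {2} else {})"
    by (auto simp: less_Suc_eq numeral_2_eq_2 intro!: gr0I split: if_splits)
  then have "min_attained_twice [a, b, c] \<longleftrightarrow>
      (a = m \<and> b = m) \<or> (a = m \<and> c = m) \<or> (b = m \<and> c = m)"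
    unfolding min_attained_twice_def m_def[symmetric] by auto
  with m show ?thesis by auto
qed

lemma min_attained_twice_matchings_if_stars:
  assumes "min_attained_twice [p12, p13, p14]" and "min_attained_twice [p12, p23, p24]"
    and "min_attained_twice [p13, p23, p34]" and "min_attained_twice [p14, p24, p34]"
  shows "min_attained_twice [p12 + p34, p13 + p24, p14 + p23]"
  using assms unfolding min_attained_twice_3_iff by (smt (verit))

lemma min_attained_twice_shift:
  "min_attained_twice [a + t, b + t, c + t] \<longleftrightarrow> min_attained_twice [a, b, c]"
  by (simp add: min_attained_twice_3_iff)

lemma valuated_matroid_lower:
  assumes inc: "tropical_incidence_relations n d \<mu> \<nu>"
  shows "valuated_matroid n d \<mu>"
  unfolding valuated_matroid_def
proof (intro allI impI, elim conjE)
  fix S i j k l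
  assume S: "S \<subseteq> {1..n}" "card S + 2 = d"
    and ijkl: "{i, j, k, l} \<subseteq> {1..n} - S" "distinct [i, j, k, l]"
  have "finite S" using S(1) finite_subset by blast
  define p where "p a b = \<mu> (S \<union> {a, b})" for a b
  define q where "q a = \<nu> (S \<union> ({i, j, k, l} - {a}))" for a
  \<comment> \<open>This is the incidence relation at \<open>insert a S\<close>, which has d - 1
    elements; \<open>q b\<close> is the value of \<nu> on \<open>S\<close> together with
    \<open>a\<close>, \<open>c\<close>, \<open>e\<close>.\<close>
  have star: "min_attained_twice [p a b + q b, p a c + q c, p a e + q e]"
    if abce: "{a, b, c, e} = {i, j, k, l}" "distinct [a, b, c, e]" for a b c e
  proof -
    have "a \<notin> S" using abce ijkl by blast
    then have "card (insert a S) + 1 = d" using \<open>finite S\<close> S(2) by simp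
    moreover have "insert a S \<subseteq> {1..n}" "{b, c, e} \<subseteq> {1..n} - insert a S"
      using abce ijkl S(1) by auto
    ultimately have "min_attained_twice
        [\<mu> (insert a S \<union> {b}) + \<nu> (insert a S \<union> {c, e}),
         \<mu> (insert a S \<union> {c}) + \<nu> (insert a S \<union> {b, e}),
         \<mu> (insert a S \<union> {e}) + \<nu> (insert a S \<union> {b, c})]"
      using inc abce(2) unfolding tropical_incidence_relations_def by simp
    moreover have "p a x = \<mu> (insert a S \<union> {x})" for x
      unfolding p_def by (rule arg_cong[of _ _ \<mu>]) auto
    moreover have "q b = \<nu> (insert a S \<union> {c, e})" "q c = \<nu> (insert a S \<union> {b, e})"
      "q e = \<nu> (insert a S \<union> {b, c})"
      unfolding q_def abce(1)[symmetric] using abce(2) by (auto intro!: arg_cong[of _ _ \<nu>])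
    ultimately show ?thesis by simp
  qed
  \<comment> \<open>Adding the constant \<open>q a\<close> along the star at \<open>a\<close> makes
    the weight symmetric in \<open>a\<close> and \<open>b\<close>, so it lives on edges of the
    graph.\<close>
  define P where "P a b = p a b + q a + q b" for a b
  have P_star: "min_attained_twice [P a b, P a c, P a e]"
    if "{a, b, c, e} = {i, j, k, l}" "distinct [a, b, c, e]" for a b c e
    using star[OF that] min_attained_twice_shift[of "p a b + q b" "q a" "p a c + q c" "p a e + q e"]
    by (simp add: P_def add_ac)
  have P_sym: "P a b = P b a" for a b
    by (simp add: P_def p_def insert_commute)
  have "min_attained_twice [P i j + P k l, P i k + P j l, P i l + P j k]"
  proof (rule min_attained_twice_matchings_if_stars)
    show "min_attained_twice [P i j, P i k, P i l]"
      using P_star[of i j k l] ijkl(2) by simp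
    show "min_attained_twice [P i j, P j k, P j l]"
      using P_star[of j i k l] ijkl(2) P_sym[of j i] by (simp add: insert_commute)
    show "min_attained_twice [P i k, P j k, P k l]"
      using P_star[of k i j l] ijkl(2) P_sym[of k i] P_sym[of k j] by (simp add: insert_commute)
    show "min_attained_twice [P i l, P j l, P k l]"
      using P_star[of l i j k] ijkl(2) P_sym[of l i] P_sym[of l j] P_sym[of l k]
      by (simp add: insert_commute)
  qed
  \<comment> \<open>A perfect matching covers every vertex once, so all three sums lose the same
    \<open>q i + q j + q k + q l\<close>.\<close>
  then have "min_attained_twice [p i j + p k l, p i k + p j l, p i l + p j k]"
    using min_attained_twice_shift[of "p i j + p k l" "q i + q j + q k + q l" "p i k + p j l" "p i l + p j k"]
    by (simp add: P_def add_ac)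
  then show "min_attained_twice
      [\<mu> (S \<union> {i, j}) + \<mu> (S \<union> {k, l}),
       \<mu> (S \<union> {i, k}) + \<mu> (S \<union> {j, l}),
       \<mu> (S \<union> {i, l}) + \<mu> (S \<union> {j, k})]"
    unfolding p_def .
qed

lemma valuated_matroid_upper:
  assumes inc: "tropical_incidence_relations n d \<mu> \<nu>"
  shows "valuated_matroid n (d + 1) \<nu>"
  unfolding valuated_matroid_def
proof (intro allI impI, elim conjE)
  fix S i j k l
  assume S: "S \<subseteq> {1..n}" "card S + 2 = d + 1"
    and ijkl: "{i, j, k, l} \<subseteq> {1..n} - S" "distinct [i, j, k, l]"
  define p where "p a b = \<nu> (S \<union> {a, b})" for a b
  define q where "q a = \<mu> (S \<union> {a})" for a
  \<comment> \<open>The sign is now negative because \<open>q a + p b c\<close> equals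
    \<open>P b c + (q a + q b + q c)\<close>, with the same shift for all edges of the
    triangle.\<close>
  define P where "P a b = p a b - q a - q b" for a b
  have triangle: "min_attained_twice [P b c, P a c, P a b]"
    if "{a, b, c} \<subseteq> {i, j, k, l}" "distinct [a, b, c]" for a b c
  proof -
    have "{a, b, c} \<subseteq> {1..n} - S" "card S + 1 = d"
      using that ijkl(1) S(2) by auto
    then have "min_attained_twice [q a + p b c, q b + p a c, q c + p a b]"
      using inc S(1) that(2) unfolding tropical_incidence_relations_def p_def q_def by blast
    then show ?thesis
      using min_attained_twice_shift[of "P b c" "q a + q b + q c" "P a c" "P a b"]
      by (simp add: P_def add_ac)
  qed
  \<comment> \<open>Every edge is replaced by its opposite one, \<open>p12\<close> being
    \<open>P k l\<close> and so on; the four star hypotheses then become the four triangles.\<close>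
  have "min_attained_twice [P k l + P i j, P j l + P i k, P j k + P i l]"
    by (rule min_attained_twice_matchings_if_stars; rule triangle) (use ijkl(2) in auto)
  then have "min_attained_twice [p i j + p k l, p i k + p j l, p i l + p j k]"
    using min_attained_twice_shift[of "P k l + P i j" "q i + q j + q k + q l" "P j l + P i k" "P j k + P i l"]
    by (simp add: P_def add_ac)
  then show "min_attained_twice
      [\<nu> (S \<union> {i, j}) + \<nu> (S \<union> {k, l}),
       \<nu> (S \<union> {i, k}) + \<nu> (S \<union> {j, l}),
       \<nu> (S \<union> {i, l}) + \<nu> (S \<union> {j, k})]"
    unfolding p_def .
qed

theorem theorem10:
  fixes n d :: nat and \<mu> \<nu> :: "nat set \<Rightarrow> real"
  assumes "1 \<le> d" and "d \<le> n - 1"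
    and "tropical_incidence_relations n d \<mu> \<nu>"
  shows "valuated_matroid n d \<mu> \<and> valuated_matroid n (d + 1) \<nu>"
  using assms(3) valuated_matroid_lower valuated_matroid_upper by blast

end
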